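(* Let $\{K_i\}_{i\ge 0}$ be a filtration of finite simplicial complexes. Suppose that there exists an index $t$ such that $K_t$ is contractible and not collapsible. Then $$M(K_t)\ge 2.$$ Moreover, if $K_{t-1}$ and $K_{t+1}$ are collapsible, then $$M(K_{t-1})=M(K_{t+1})=1,$$ and consequently a Morse spike occurs at the index $t$.
   Context: A filtration is an increasing sequence of simplicial complexes $K_0\subseteq K_1\subseteq\cdots$, each a subcomplex of the next. Homology is with integer coefficients. A discrete Morse function on a finite simplicial complex $K$ is a function $f$ from the set of simplices of $K$ to $\mathbb{R}$ such that for every simplex $\sigma^r$ (of dimension $r$) the set $\widetilde{M}(\sigma)=\{\tau^{r-1}\subset\sigma^r : f(\tau)\ge f(\sigma)\}\cup\{\tau^{r+1}\supset\sigma^r : f(\tau)\le f(\sigma)\}$ contains at most one element. A simplex $\sigma$ is critical for $f$ if $\widetilde{M}(\sigma)=\varnothing$. Let $c_i(f)$ be the number of critical $i$-simplices of $f$. The minimal Morse number is $M(K)=\min_f \sum_{i\ge 0} c_i(f)$, the minimum being over all discrete Morse functions $f$ on $K$. An elementary collapse from $K$ to $L$ occurs if there are simplices $\sigma,\tau\in K$ such that $\sigma$ is a proper face of $\tau$, $\tau$ is the unique simplex of $K$ properly containing $\sigma$, and $L=K\setminus\{\sigma,\tau\}$. A simplicial complex is collapsible if it can be reduced to a single vertex by a sequence of elementary collapses. It is contractible if it is homotopy equivalent to a point. A Morse spike occurs at $t$ if: (i) $H_*(K_{t-1})\cong H_*(K_t)\cong H_*(K_{t+1})$; (ii) $M(K_t)>M(K_{t-1})$;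 and (iii) $M(K_t)>M(K_{t+1})$. *)

theory Defs
  imports "HOL-Homology.Homology"
begin

section \<open>Finite simplicial complexes and filtrations\<close>

text \<open>
  A finite abstract simplicial complex is represented by its set of simplices, each simplex being
  its finite nonempty set of vertices. The empty face is never a simplex; the empty complex is
  allowed.
\<close>

definition finite_complex :: "'v set set \<Rightarrow> bool" where
  "finite_complex K \<longleftrightarrow>
     finite K \<and> (\<forall>\<sigma>\<in>K. finite \<sigma> \<and> \<sigma> \<noteq> {}) \<and>
     (\<forall>\<sigma>\<in>K. \<forall>\<tau>. \<tau> \<noteq> {} \<and> \<tau> \<subseteq> \<sigma> \<longrightarrow> \<tau> \<in> K)"

text \<open>Only applied to nonempty simplices, so the subtraction never truncates.\<close>

definition simplex_dim :: "'v set \<Rightarrow> nat" where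
  "simplex_dim \<sigma> = card \<sigma> - 1"

definition filtration :: "(nat \<Rightarrow> 'v set set) \<Rightarrow> bool" where
  "filtration K \<longleftrightarrow> (\<forall>i. finite_complex (K i)) \<and> (\<forall>i. K i \<subseteq> K (Suc i))"


section \<open>Discrete Morse functions\<close>

definition morse_set :: "'v set set \<Rightarrow> ('v set \<Rightarrow> real) \<Rightarrow> 'v set \<Rightarrow> 'v set set" where
  "morse_set K f \<sigma> =
     {\<tau>\<in>K. \<tau> \<subset> \<sigma> \<and> simplex_dim \<sigma> = simplex_dim \<tau> + 1 \<and> f \<tau> \<ge> f \<sigma>} \<union>
     {\<tau>\<in>K. \<sigma> \<subset> \<tau> \<and> simplex_dim \<tau> = simplex_dim \<sigma> + 1 \<and> f \<tau> \<le> f \<sigma>}"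

text \<open>The values of \<open>f\<close> outside \<open>K\<close> are irrelevant.\<close>

definition discrete_morse_function :: "'v set set \<Rightarrow> ('v set \<Rightarrow> real) \<Rightarrow> bool" where
  "discrete_morse_function K f \<longleftrightarrow>
     (\<forall>\<sigma>\<in>K. finite (morse_set K f \<sigma>) \<and> card (morse_set K f \<sigma>) \<le> 1)"

definition critical :: "'v set set \<Rightarrow> ('v set \<Rightarrow> real) \<Rightarrow> 'v set \<Rightarrow> bool" where
  "critical K f \<sigma> \<longleftrightarrow> \<sigma> \<in> K \<and> morse_set K f \<sigma> = {}"

definition critical_count :: "'v set set \<Rightarrow> ('v set \<Rightarrow> real) \<Rightarrow> nat \<Rightarrow> nat" where
  "critical_count K f i = card {\<sigma>. critical K f \<sigma> \<and> simplex_dim \<sigma> = i}"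

text \<open>
  The sum over all \<open>i \<ge> 0\<close> is restricted to the dimensions that occur in \<open>K\<close>, as
  \<open>critical_count K f i = 0\<close> for all other \<open>i\<close>.
\<close>

definition total_critical_count :: "'v set set \<Rightarrow> ('v set \<Rightarrow> real) \<Rightarrow> nat" where
  "total_critical_count K f = (\<Sum>i \<in> simplex_dim ` K. critical_count K f i)"

definition minimal_morse_number :: "'v set set \<Rightarrow> nat" where
  "minimal_morse_number K =
     (LEAST m. \<exists>f. discrete_morse_function K f \<and> m = total_critical_count K f)"

text \<open>The minimum is over a nonempty set: the dimension function is a discrete Morse function.\<close>

lemma discrete_morse_function_dim:
  "discrete_morse_function K (\<lambda>\<sigma>. real (simplex_dim \<sigma>))"
proof -
  have "morse_set K (\<lambda>\<sigma>. real (simplex_dim \<sigma>)) \<sigma> = {}" for \<sigma>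
    by (auto simp: morse_set_def)
  then show ?thesis by (simp add: discrete_morse_function_def)
qed


section \<open>Collapses\<close>

definition elementary_collapse :: "'v set set \<Rightarrow> 'v set set \<Rightarrow> bool" where
  "elementary_collapse K L \<longleftrightarrow>
     (\<exists>\<sigma>\<in>K. \<exists>\<tau>\<in>K. \<sigma> \<subset> \<tau> \<and> (\<forall>\<rho>\<in>K. \<sigma> \<subset> \<rho> \<longrightarrow> \<rho> = \<tau>) \<and> L = K - {\<sigma>, \<tau>})"

definition collapsible :: "'v set set \<Rightarrow> bool" where
  "collapsible K \<longleftrightarrow> (\<exists>v. elementary_collapse\<^sup>*\<^sup>* K {{v}})"


section \<open>Topology of a complex\<close>

text \<open>
  Points of the geometric realization are given by their barycentric coordinates: nonnegative
  functions on the vertices with coordinate sum 1 whose support is a simplex. For a finite complex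
  the topology induced by the product topology is the usual (Euclidean) one.
\<close>

definition geometric_realization :: "'v set set \<Rightarrow> ('v \<Rightarrow> real) topology" where
  "geometric_realization K =
     subtopology (powertop_real UNIV)
       {x. (\<forall>v. 0 \<le> x v) \<and> {v. x v \<noteq> 0} \<in> K \<and> (\<Sum>v | x v \<noteq> 0. x v) = 1}"

text \<open>
  The library's \<^const>\<open>contractible_space\<close> also holds for the empty space, which is not
  homotopy equivalent to a point.
\<close>

definition contractible_complex :: "'v set set \<Rightarrow> bool" where
  "contractible_complex K \<longleftrightarrow>
     geometric_realization K homotopy_equivalent_space discrete_topology {()}"

text \<open>Integral homology of a complex is the singular homology of its realization.\<close>

definition isomorphic_homology :: "'v set set \<Rightarrow> 'v set set \<Rightarrow> bool" where
  "isomorphic_homology K L \<longleftrightarrow>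
     (\<forall>p. homology_group p (geometric_realization K) \<cong> homology_group p (geometric_realization L))"

definition morse_spike :: "(nat \<Rightarrow> 'v set set) \<Rightarrow> nat \<Rightarrow> bool" where
  "morse_spike K t \<longleftrightarrow>
     t \<ge> 1 \<and>
     isomorphic_homology (K (t - 1)) (K t) \<and>
     isomorphic_homology (K t) (K (t + 1)) \<and>
     minimal_morse_number (K t) > minimal_morse_number (K (t - 1)) \<and>
     minimal_morse_number (K t) > minimal_morse_number (K (t + 1))"

end

theory Submission
  imports Defs
begin

text \<open>
  The Morse number of a nonempty complex is at least 1, because a vertex of least value is critical
  for every discrete Morse function (\<open>exists_critical_vertex\<close>). The value 1 characterizes
  collapsibility.

  If a discrete Morse function has a single critical simplex, then that simplex is a vertex, so in
  positive dimension every top-dimensional simplex is paired with a facet. For the top-dimensional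
  simplex \<open>\<tau>\<close> of largest value this facet \<open>\<sigma>\<close> is free: any other simplex on \<open>\<sigma>\<close> would have
  to take a larger value than \<open>\<tau>\<close>. Removing the pair \<open>\<sigma>\<close>, \<open>\<tau>\<close> is an elementary collapse that
  leaves the other pairs intact, so induction collapses the complex to the critical vertex
  (\<open>unique_critical_imp_collapsible\<close>). Hence a nonempty complex that is not collapsible has Morse
  number at least 2. Conversely, reading a collapse backwards, every pair that is put back receives
  one common value above all previous values; this creates no critical simplex, so a collapsible
  complex has Morse number 1 (\<open>extend_morse_function\<close>).

  The homology condition of a Morse spike holds because collapsible complexes are contractible
  (\<open>collapsible_imp_contractible_complex\<close>): the space of an elementary collapse is a deformation
  retract, by a homotopy that is given by one formula in barycentric coordinates. So all three
  complexes are homotopy equivalent to a point.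
\<close>

section \<open>Critical simplices\<close>

lemma finite_complexD:
  assumes "finite_complex K"
  shows finite_complex_finite: "finite K"
    and finite_complex_simplex: "\<sigma> \<in> K \<Longrightarrow> finite \<sigma> \<and> \<sigma> \<noteq> {}"
    and finite_complex_face: "\<sigma> \<in> K \<Longrightarrow> \<tau> \<noteq> {} \<Longrightarrow> \<tau> \<subseteq> \<sigma> \<Longrightarrow> \<tau> \<in> K"
  using assms unfolding finite_complex_def by blast+

lemma total_critical_count_eq_card:
  assumes "finite K"
  shows "total_critical_count K f = card {\<sigma>. critical K f \<sigma>}"
proof -
  let ?C = "{\<sigma>. critical K f \<sigma>}"
  have sub: "?C \<subseteq> K" by (auto simp: critical_def)
  then have fin: "finite ?C" using assms finite_subset by blast
  have "(\<Sum>i\<in>simplex_dim ` K. \<Sum>\<sigma>\<in>{\<sigma>\<in>?C. simplex_dim \<sigma> = i}. 1) = (\<Sum>\<sigma>\<in>?C. (1::nat))"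
    using sub fin assms by (intro sum.group) auto
  then show ?thesis
    by (simp add: total_critical_count_def critical_count_def)
qed

lemma minimal_morse_number_attained:
  obtains f where "discrete_morse_function K f"
    and "minimal_morse_number K = total_critical_count K f"
  using LeastI_ex[of "\<lambda>m. \<exists>f. discrete_morse_function K f \<and> m = total_critical_count K f"]
    discrete_morse_function_dim[of K]
  unfolding minimal_morse_number_def by blast

lemma minimal_morse_number_le:
  "discrete_morse_function K f \<Longrightarrow> minimal_morse_number K \<le> total_critical_count K f"
  unfolding minimal_morse_number_def by (rule Least_le) blast

text \<open>
  In a discrete Morse function, the noncritical simplices thus come in pairs: by this symmetry and
  the following uniqueness, the relation given by \<^const>\<open>morse_set\<close> is a matching.
\<close>

lemma morse_set_sym:
  assumes "\<rho> \<in> morse_set K f \<sigma>" and "\<sigma> \<in> K"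
  shows "\<sigma> \<in> morse_set K f \<rho>"
  using assms unfolding morse_set_def by auto

lemma morse_set_unique:
  assumes "discrete_morse_function K f" and "\<sigma> \<in> K"
    and "\<rho> \<in> morse_set K f \<sigma>" and "\<rho>' \<in> morse_set K f \<sigma>"
  shows "\<rho> = \<rho>'"
  using assms unfolding discrete_morse_function_def
  by (metis One_nat_def card_le_Suc0_iff_eq)

text \<open>
  A vertex of least value works: if an edge at it had no larger value, then both ends of that edge
  would lie in the edge's \<^const>\<open>morse_set\<close>.
\<close>

lemma exists_critical_vertex:
  assumes K: "finite_complex K" and "K \<noteq> {}" and f: "discrete_morse_function K f"
  obtains v where "critical K f {v}"
proof -
  let ?V = "{v. {v} \<in> K}"
  obtain \<sigma> where "\<sigma> \<in> K" using \<open>K \<noteq> {}\<close> by blast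
  then obtain u where "u \<in> \<sigma>" using finite_complex_simplex[OF K] by blast
  then have "{u} \<in> K" using finite_complex_face[OF K \<open>\<sigma> \<in> K\<close>] by blast
  have "finite ((\<lambda>v. {v}) ` ?V)"
    by (rule finite_subset[OF _ finite_complex_finite[OF K]]) auto
  then have "finite ?V" by (rule finite_imageD) auto
  then obtain v where "is_arg_min (\<lambda>v. f {v}) (\<lambda>v. v \<in> ?V) v"
    using ex_is_arg_min_if_finite[of ?V "\<lambda>v. f {v}"] \<open>{u} \<in> K\<close> by blast
  then have v: "{v} \<in> K" and least: "\<And>w. {w} \<in> K \<Longrightarrow> f {v} \<le> f {w}"
    by (simp_all add: is_arg_min_linorder)
  have "morse_set K f {v} = {}"
  proof (rule ccontr)
    assume "morse_set K f {v} \<noteq> {}"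
    then obtain e where e: "e \<in> morse_set K f {v}" by blast
    then have eK: "e \<in> K" by (auto simp: morse_set_def)
    \<comment> \<open>A vertex has no proper faces, so only cofaces can obstruct criticality.\<close>
    have "\<not> e \<subset> {v}" using finite_complex_simplex[OF K eK] by auto
    with e have "{v} \<subset> e" and dim: "simplex_dim e = 1" and fe: "f e \<le> f {v}"
      by (auto simp: morse_set_def simplex_dim_def)
    then obtain w where "w \<in> e" "w \<noteq> v" by blast
    have "{w} \<subset> e" using \<open>w \<in> e\<close> \<open>w \<noteq> v\<close> \<open>{v} \<subset> e\<close> by blast
    have "{w} \<in> K" using finite_complex_face[OF K eK] \<open>w \<in> e\<close> by blast
    have "{w} \<in> morse_set K f e"
      using \<open>{w} \<in> K\<close> \<open>{w} \<subset> e\<close> dim fe least[OF \<open>{w} \<in> K\<close>]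
      by (auto simp: morse_set_def simplex_dim_def)
    moreover have "{v} \<in> morse_set K f e" using morse_set_sym[OF e v] .
    ultimately show False using morse_set_unique[OF f eK] \<open>w \<noteq> v\<close> by blast
  qed
  then show ?thesis using that v by (auto simp: critical_def)
qed

lemma minimal_morse_number_pos:
  assumes K: "finite_complex K" and "K \<noteq> {}"
  shows "minimal_morse_number K \<ge> 1"
proof -
  obtain f where f: "discrete_morse_function K f"
    and M: "minimal_morse_number K = total_critical_count K f"
    by (rule minimal_morse_number_attained)
  obtain v where "critical K f {v}" using exists_critical_vertex[OF assms f] .
  moreover have "finite {\<sigma>. critical K f \<sigma>}"
    by (rule finite_subset[OF _ finite_complex_finite[OF K]]) (auto simp: critical_def)
  ultimately have "card {\<sigma>. critical K f \<sigma>} > 0" by (auto simp: card_gt_0_iff)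
  then show ?thesis
    by (simp add: M total_critical_count_eq_card[OF finite_complex_finite[OF K]])
qed


section \<open>Elementary collapses\<close>

text \<open>
  A free face is a facet: for any vertex \<open>w\<close> of \<open>\<tau>\<close> outside \<open>\<sigma>\<close>, the face \<open>\<sigma> \<union> {w}\<close> of \<open>\<tau>\<close>
  already is a proper coface of \<open>\<sigma>\<close>, so it is \<open>\<tau>\<close>.
\<close>

lemma elementary_collapseE:
  assumes "finite_complex K" and "elementary_collapse K L"
  obtains \<sigma> w where "\<sigma> \<in> K" "w \<notin> \<sigma>" "insert w \<sigma> \<in> K"
    "\<And>\<rho>. \<rho> \<in> K \<Longrightarrow> \<sigma> \<subset> \<rho> \<Longrightarrow> \<rho> = insert w \<sigma>" "L = K - {\<sigma>, insert w \<sigma>}"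
proof -
  obtain \<sigma> \<tau> where *: "\<sigma> \<in> K" "\<tau> \<in> K" "\<sigma> \<subset> \<tau>" and uniq: "\<And>\<rho>. \<rho> \<in> K \<Longrightarrow> \<sigma> \<subset> \<rho> \<Longrightarrow> \<rho> = \<tau>"
    and L: "L = K - {\<sigma>, \<tau>}"
    using assms(2) unfolding elementary_collapse_def by blast
  obtain w where w: "w \<in> \<tau>" "w \<notin> \<sigma>" using \<open>\<sigma> \<subset> \<tau>\<close> by blast
  have "insert w \<sigma> \<in> K"
    using finite_complex_face[OF assms(1) \<open>\<tau> \<in> K\<close>, of "insert w \<sigma>"] * w by blast
  then have "\<tau> = insert w \<sigma>" using uniq[of "insert w \<sigma>"] w by blast
  then show ?thesis using that[of \<sigma> w] * w uniq L by blast
qed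

lemma finite_complex_elementary_collapse:
  assumes K: "finite_complex K" and "elementary_collapse K L"
  shows "finite_complex L"
proof -
  obtain \<sigma> w where *: "\<sigma> \<in> K" "w \<notin> \<sigma>" "insert w \<sigma> \<in> K"
    "\<And>\<rho>. \<rho> \<in> K \<Longrightarrow> \<sigma> \<subset> \<rho> \<Longrightarrow> \<rho> = insert w \<sigma>" and L: "L = K - {\<sigma>, insert w \<sigma>}"
    using elementary_collapseE[OF assms] by metis
  have face: "\<tau> \<in> L" if "\<rho> \<in> L" "\<tau> \<noteq> {}" "\<tau> \<subseteq> \<rho>" for \<rho> \<tau>
  proof -
    have "\<tau> \<in> K" using finite_complex_face[OF K _ that(2,3)] that L by blast
    have "\<not> \<sigma> \<subseteq> \<rho>" using *(4)[of \<rho>] that L by blast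
    then show ?thesis using \<open>\<tau> \<in> K\<close> that L by auto
  qed
  have "finite L" using finite_complex_finite[OF K] L by simp
  moreover have "\<forall>\<rho>\<in>L. finite \<rho> \<and> \<rho> \<noteq> {}" using finite_complex_simplex[OF K] L by blast
  ultimately show ?thesis using face unfolding finite_complex_def by blast
qed

text \<open>
  This rule runs backwards along a collapse: properties pass from the smaller complex to the larger
  one, starting at the final vertex.
\<close>

lemma collapsible_finite_complex_induct [consumes 2, case_names vertex collapse]:
  assumes "collapsible K" and "finite_complex K"
    and vertex: "\<And>v. P {{v}}"
    and collapse: "\<And>K L. \<lbrakk>finite_complex K; elementary_collapse K L; finite_complex L; P L\<rbrakk> \<Longrightarrow> P K"
  shows "P K"
proof -
  obtain v where "elementary_collapse\<^sup>*\<^sup>* K {{v}}"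
    using assms(1) by (auto simp: collapsible_def)
  then show ?thesis using \<open>finite_complex K\<close>
  proof (induction rule: converse_rtranclp_induct)
    case base
    show ?case by (rule vertex)
  next
    case (step K L)
    then show ?case using collapse finite_complex_elementary_collapse by blast
  qed
qed


section \<open>Collapses from discrete Morse functions\<close>

lemma morse_set_mono: "L \<subseteq> K \<Longrightarrow> morse_set L f \<sigma> \<subseteq> morse_set K f \<sigma>"
  by (auto simp: morse_set_def)

lemma discrete_morse_function_subset:
  assumes f: "discrete_morse_function K f" and "L \<subseteq> K"
  shows "discrete_morse_function L f"
  unfolding discrete_morse_function_def
proof
  fix \<sigma> assume "\<sigma> \<in> L"
  then have "finite (morse_set K f \<sigma>)" "card (morse_set K f \<sigma>) \<le> 1"
    using assms by (auto simp: discrete_morse_function_def)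
  then show "finite (morse_set L f \<sigma>) \<and> card (morse_set L f \<sigma>) \<le> 1"
    using morse_set_mono[OF \<open>L \<subseteq> K\<close>, of f \<sigma>] finite_subset card_mono le_trans by meson
qed

text \<open>
  The simplex \<open>\<tau>\<close> has top dimension, so its partner is a facet \<open>\<sigma>\<close> with \<open>f \<sigma> \<ge> f \<tau>\<close>. A second
  simplex \<open>\<rho>\<close> on \<open>\<sigma>\<close> also has top dimension; by maximality \<open>f \<rho> \<le> f \<tau> \<le> f \<sigma>\<close>, so \<open>\<rho>\<close> is another
  partner of \<open>\<sigma>\<close>, against uniqueness.
\<close>

lemma free_face_of_maximal_value:
  assumes K: "finite_complex K" and f: "discrete_morse_function K f"
    and \<tau>: "\<tau> \<in> K" "simplex_dim \<tau> \<ge> 1" "\<not> critical K f \<tau>"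
    and top: "\<And>\<rho>. \<rho> \<in> K \<Longrightarrow> simplex_dim \<rho> \<le> simplex_dim \<tau>"
    and max: "\<And>\<rho>. \<rho> \<in> K \<Longrightarrow> simplex_dim \<rho> = simplex_dim \<tau> \<Longrightarrow> f \<rho> \<le> f \<tau>"
  obtains \<sigma> where "\<sigma> \<in> morse_set K f \<tau>" "\<sigma> \<subset> \<tau>" "\<sigma> \<in> K" "\<And>\<rho>. \<rho> \<in> K \<Longrightarrow> \<sigma> \<subset> \<rho> \<Longrightarrow> \<rho> = \<tau>"
proof -
  obtain \<sigma> where \<sigma>: "\<sigma> \<in> morse_set K f \<tau>" using \<tau> by (auto simp: critical_def)
  then have \<sigma>K: "\<sigma> \<in> K" by (auto simp: morse_set_def)
  have sub: "\<sigma> \<subset> \<tau>" and dim: "simplex_dim \<tau> = simplex_dim \<sigma> + 1" and ge: "f \<sigma> \<ge> f \<tau>"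
    using \<sigma> top[OF \<sigma>K] by (auto simp: morse_set_def)
  have "\<rho> = \<tau>" if "\<rho> \<in> K" "\<sigma> \<subset> \<rho>" for \<rho>
  proof -
    have "card \<sigma> < card \<rho>" "card \<sigma> > 0"
      using that finite_complex_simplex[OF K] \<sigma>K by (auto intro: psubset_card_mono simp: card_gt_0_iff)
    then have dim\<rho>: "simplex_dim \<rho> = simplex_dim \<sigma> + 1"
      using top[OF \<open>\<rho> \<in> K\<close>] dim by (simp add: simplex_dim_def)
    then have "\<rho> \<in> morse_set K f \<sigma>"
      using that max[OF \<open>\<rho> \<in> K\<close>] dim ge by (auto simp: morse_set_def)
    then show ?thesis
      using morse_set_unique[OF f \<sigma>K _ morse_set_sym[OF \<sigma> \<tau>(1)]] by blast
  qed
  then show ?thesis using that \<sigma> sub \<sigma>K by blast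
qed

text \<open>
  Partners are mutual, so a simplex other than \<open>\<sigma>\<close> and \<open>\<tau>\<close> keeps its partner when these two are
  removed.
\<close>

lemma critical_after_removing_pair:
  assumes f: "discrete_morse_function K f"
    and \<tau>: "\<tau> \<in> K" and \<sigma>: "\<sigma> \<in> morse_set K f \<tau>"
    and crit: "critical (K - {\<sigma>, \<tau>}) f \<rho>"
  shows "critical K f \<rho>"
proof (rule ccontr)
  assume no: "\<not> critical K f \<rho>"
  have \<rho>: "\<rho> \<in> K" "\<rho> \<noteq> \<sigma>" "\<rho> \<noteq> \<tau>" using crit by (auto simp: critical_def)
  have \<sigma>K: "\<sigma> \<in> K" using \<sigma> by (auto simp: morse_set_def)
  obtain \<rho>' where \<rho>': "\<rho>' \<in> morse_set K f \<rho>" using no \<rho> by (auto simp: critical_def)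
  have adj: "\<rho> \<in> morse_set K f \<rho>'" using morse_set_sym[OF \<rho>' \<rho>(1)] .
  have "\<rho>' \<noteq> \<tau>" using morse_set_unique[OF f \<tau> \<sigma>] adj \<rho> by blast
  moreover have "\<rho>' \<noteq> \<sigma>"
    using morse_set_unique[OF f \<sigma>K morse_set_sym[OF \<sigma> \<tau>]] adj \<rho> by blast
  ultimately have "\<rho>' \<in> morse_set (K - {\<sigma>, \<tau>}) f \<rho>"
    using \<rho>' by (auto simp: morse_set_def)
  then show False using crit by (auto simp: critical_def)
qed

text \<open>
  In dimension 0 every simplex is critical, so only \<open>{v}\<close> is there. In positive dimension the top
  simplex of largest value is matched with a free face, and removing both preserves the hypotheses.
\<close>

lemma unique_critical_imp_collapsible:
  assumes "finite_complex K" and "discrete_morse_function K f"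
    and "{\<sigma>. critical K f \<sigma>} = {{v}}"
  shows "collapsible K"
  using assms
proof (induction "card K" arbitrary: K rule: less_induct)
  case less
  note K = less.prems(1) and f = less.prems(2)
  have crit: "critical K f \<rho> \<longleftrightarrow> \<rho> = {v}" for \<rho> using less.prems(3) by auto
  have finK: "finite K" using finite_complex_finite[OF K] .
  have vK: "{v} \<in> K" using crit[of "{v}"] by (simp add: critical_def)
  define d where "d = Max (simplex_dim ` K)"
  have d: "\<And>\<rho>. \<rho> \<in> K \<Longrightarrow> simplex_dim \<rho> \<le> d" using finK by (simp add: d_def)
  show ?case
  proof (cases "d = 0")
    case True
    have "\<rho> = {v}" if \<rho>: "\<rho> \<in> K" for \<rho>
    proof -
      have "morse_set K f \<rho> = {}" using d \<rho> True by (fastforce simp: morse_set_def)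
      then show ?thesis using crit[of \<rho>] \<rho> by (simp add: critical_def)
    qed
    then have "K = {{v}}" using vK by blast
    then show ?thesis unfolding collapsible_def by blast
  next
    case False
    let ?T = "{\<rho> \<in> K. simplex_dim \<rho> = d}"
    have "d \<in> simplex_dim ` K" unfolding d_def using finK vK by (intro Max_in) auto
    then have "finite ?T" "?T \<noteq> {}" using finK by auto
    then obtain \<tau> where "is_arg_min (\<lambda>\<rho>. - f \<rho>) (\<lambda>\<rho>. \<rho> \<in> ?T) \<tau>"
      using ex_is_arg_min_if_finite by blast
    then have \<tau>: "\<tau> \<in> ?T" and max: "\<And>\<rho>. \<rho> \<in> ?T \<Longrightarrow> f \<rho> \<le> f \<tau>"
      by (simp_all add: is_arg_min_linorder)
    have "\<tau> \<noteq> {v}" using \<tau> False by (auto simp: simplex_dim_def)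
    then have nc: "\<not> critical K f \<tau>" using crit by blast
    have \<tau>K: "\<tau> \<in> K" and dim: "simplex_dim \<tau> = d" using \<tau> by auto
    have dim1: "simplex_dim \<tau> \<ge> 1" using dim False by simp
    have top: "\<And>\<rho>. \<rho> \<in> K \<Longrightarrow> simplex_dim \<rho> \<le> simplex_dim \<tau>" using d dim by simp
    have top_max: "\<And>\<rho>. \<rho> \<in> K \<Longrightarrow> simplex_dim \<rho> = simplex_dim \<tau> \<Longrightarrow> f \<rho> \<le> f \<tau>"
      using max dim by simp
    obtain \<sigma> where \<sigma>: "\<sigma> \<in> morse_set K f \<tau>" "\<sigma> \<subset> \<tau>" "\<sigma> \<in> K"
      and free: "\<And>\<rho>. \<rho> \<in> K \<Longrightarrow> \<sigma> \<subset> \<rho> \<Longrightarrow> \<rho> = \<tau>"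
      using free_face_of_maximal_value[OF K f \<tau>K dim1 nc top top_max] by metis
    define L where "L = K - {\<sigma>, \<tau>}"
    have KL: "elementary_collapse K L"
      unfolding elementary_collapse_def L_def using \<sigma>(2,3) \<tau>K free by blast
    have "\<tau> \<in> morse_set K f \<sigma>" using morse_set_sym[OF \<sigma>(1) \<tau>K] .
    then have "\<sigma> \<noteq> {v}" using crit[of "{v}"] by (auto simp: critical_def)
    have "critical L f {v}"
      using crit[of "{v}"] \<open>\<sigma> \<noteq> {v}\<close> \<open>\<tau> \<noteq> {v}\<close> by (auto simp: critical_def L_def morse_set_def)
    moreover have "\<rho> = {v}" if "critical L f \<rho>" for \<rho>
      using critical_after_removing_pair[OF f _ \<sigma>(1)] that \<tau> crit unfolding L_def by blast
    ultimately have "{\<rho>. critical L f \<rho>} = {{v}}" by blast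
    moreover have "card L < card K"
      using finK \<sigma>(3) unfolding L_def by (intro psubset_card_mono) auto
    moreover have "discrete_morse_function L f"
      using discrete_morse_function_subset[OF f] by (simp add: L_def)
    ultimately have "collapsible L"
      using less.hyps finite_complex_elementary_collapse[OF K KL] by blast
    then show ?thesis
      using KL unfolding collapsible_def by (meson converse_rtranclp_into_rtranclp)
  qed
qed

theorem not_collapsible_imp_minimal_morse_number_ge_2:
  assumes K: "finite_complex K" and "K \<noteq> {}" and "\<not> collapsible K"
  shows "minimal_morse_number K \<ge> 2"
proof (rule ccontr)
  assume "\<not> minimal_morse_number K \<ge> 2"
  with minimal_morse_number_pos[OF assms(1,2)] have M1: "minimal_morse_number K = 1" by simp
  obtain f where f: "discrete_morse_function K f"
    and M: "minimal_morse_number K = total_critical_count K f"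
    by (rule minimal_morse_number_attained)
  have "card {\<sigma>. critical K f \<sigma>} = 1"
    using M1 M total_critical_count_eq_card[OF finite_complex_finite[OF K]] by simp
  then obtain c where c: "{\<sigma>. critical K f \<sigma>} = {c}" by (auto simp: card_1_singleton_iff)
  obtain v where "critical K f {v}" using exists_critical_vertex[OF assms(1,2) f] .
  with c have "c = {v}" by auto
  then show False using unique_critical_imp_collapsible[OF K f] c assms(3) by blast
qed


section \<open>Discrete Morse functions from collapses\<close>

text \<open>
  The simplices \<open>\<sigma>\<close> and \<open>\<tau>\<close> of the collapse get a common value \<open>C\<close> that exceeds all values on
  \<open>L\<close>. Equal values match them with each other. No simplex of \<open>L\<close> is a coface of either, and a face
  in \<open>L\<close> has a smaller value, so nothing in \<open>L\<close> is matched with them.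
\<close>

lemma extend_morse_function:
  assumes K: "finite_complex K" and KL: "elementary_collapse K L"
    and f: "discrete_morse_function L f"
  obtains g where "discrete_morse_function K g" "{\<sigma>. critical K g \<sigma>} = {\<sigma>. critical L f \<sigma>}"
proof -
  obtain \<sigma> w where \<sigma>: "\<sigma> \<in> K" "w \<notin> \<sigma>" "insert w \<sigma> \<in> K"
    and free: "\<And>\<rho>. \<rho> \<in> K \<Longrightarrow> \<sigma> \<subset> \<rho> \<Longrightarrow> \<rho> = insert w \<sigma>" and L: "L = K - {\<sigma>, insert w \<sigma>}"
    using elementary_collapseE[OF K KL] by metis
  define \<tau> where "\<tau> = insert w \<sigma>"
  have \<sigma>\<tau>: "\<sigma> \<subset> \<tau>" "\<tau> \<in> K" using \<sigma> by (auto simp: \<tau>_def)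
  have dim: "simplex_dim \<tau> = simplex_dim \<sigma> + 1"
    using \<sigma> finite_complex_simplex[OF K, of \<sigma>] by (auto simp: \<tau>_def simplex_dim_def card_gt_0_iff)
  have finL: "finite L" using finite_complex_finite[OF K] L by simp
  \<comment> \<open>Inserting 0 makes the maximum defined without an argument that \<open>L\<close> is nonempty.\<close>
  define C where "C = Max (insert 0 (f ` L)) + 1"
  have C: "f \<rho> < C" if "\<rho> \<in> L" for \<rho>
  proof -
    have "f \<rho> \<le> Max (insert 0 (f ` L))" using finL that by (intro Max_ge) auto
    then show ?thesis by (simp add: C_def)
  qed
  define g where "g \<rho> = (if \<rho> \<in> L then f \<rho> else C)" for \<rho>
  have K_eq: "K = insert \<sigma> (insert \<tau> L)" and notin: "\<sigma> \<notin> L" "\<tau> \<notin> L"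
    using \<sigma> by (auto simp: L \<tau>_def)
  have gC: "g \<sigma> = C" "g \<tau> = C" "\<And>\<rho>. \<rho> \<in> L \<Longrightarrow> g \<rho> < C" using C notin by (auto simp: g_def)
  have no_coface: "\<not> \<sigma> \<subset> \<rho>" "\<not> \<tau> \<subset> \<rho>" if "\<rho> \<in> L" for \<rho>
    using free[of \<rho>] that \<sigma>\<tau> L by (auto simp: \<tau>_def)
  have pair: "\<tau> \<in> morse_set K g \<sigma>" "\<sigma> \<in> morse_set K g \<tau>"
    using gC(1,2) \<sigma>\<tau> \<sigma>(1) dim by (simp_all add: morse_set_def)
  have no_other: "\<rho> \<notin> morse_set K g \<sigma>" "\<rho> \<notin> morse_set K g \<tau>" if "\<rho> \<in> L" for \<rho>
    using gC(1,2) gC(3)[OF that] no_coface[OF that] by (simp_all add: morse_set_def)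
  have in_K: "morse_set K g \<rho> \<subseteq> K - {\<rho>}" for \<rho> by (auto simp: morse_set_def)
  have m_\<sigma>: "morse_set K g \<sigma> = {\<tau>}" and m_\<tau>: "morse_set K g \<tau> = {\<sigma>}"
    using pair no_other in_K[of \<sigma>] in_K[of \<tau>] K_eq by blast+
  have m_L: "morse_set K g \<rho> = morse_set L f \<rho>" if "\<rho> \<in> L" for \<rho>
  proof -
    have "morse_set K g \<rho> = morse_set L g \<rho>"
      using gC(1,2) gC(3)[OF that] no_coface[OF that] unfolding morse_set_def K_eq by auto
    also have "\<dots> = morse_set L f \<rho>" using that by (auto simp: morse_set_def g_def)
    finally show ?thesis .
  qed
  have "discrete_morse_function K g"
    using f m_\<sigma> m_\<tau> m_L by (auto simp: discrete_morse_function_def K_eq)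
  moreover have "{\<rho>. critical K g \<rho>} = {\<rho>. critical L f \<rho>}"
    using m_\<sigma> m_\<tau> m_L notin by (auto simp: critical_def K_eq)
  ultimately show ?thesis using that by blast
qed

theorem collapsible_imp_minimal_morse_number_eq_1:
  assumes "collapsible K" and K: "finite_complex K"
  shows "minimal_morse_number K = 1"
proof -
  have "K \<noteq> {} \<and> (\<exists>f. discrete_morse_function K f \<and> card {\<sigma>. critical K f \<sigma>} = 1)"
    using assms
  proof (induction rule: collapsible_finite_complex_induct)
    case (vertex v)
    have "{\<sigma>. critical {{v}} f \<sigma>} = {{v}}" for f
      by (auto simp: critical_def morse_set_def)
    then show ?case using discrete_morse_function_dim[of "{{v}}"] by auto
  next
    case (collapse K L)
    then have "K \<noteq> {}" by (auto simp: elementary_collapse_def)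
    then show ?case using collapse.IH extend_morse_function[OF collapse.hyps(1,2)] by metis
  qed
  then obtain f where "K \<noteq> {}" and f: "discrete_morse_function K f"
    and "card {\<sigma>. critical K f \<sigma>} = 1" by blast
  then have "minimal_morse_number K \<le> 1"
    using minimal_morse_number_le[OF f] total_critical_count_eq_card[OF finite_complex_finite[OF K]]
    by simp
  then show ?thesis using minimal_morse_number_pos[OF K \<open>K \<noteq> {}\<close>] by simp
qed


section \<open>Collapses as deformation retractions\<close>

definition realization_points :: "'v set set \<Rightarrow> ('v \<Rightarrow> real) set" where
  "realization_points K = {x. (\<forall>v. 0 \<le> x v) \<and> {v. x v \<noteq> 0} \<in> K \<and> (\<Sum>v | x v \<noteq> 0. x v) = 1}"

lemma geometric_realization_eq:
  "geometric_realization K = subtopology (powertop_real UNIV) (realization_points K)"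
  by (simp add: geometric_realization_def realization_points_def)

lemma topspace_geometric_realization: "topspace (geometric_realization K) = realization_points K"
  by (simp add: geometric_realization_eq)

text \<open>
  For a free face \<open>\<sigma>\<close> of \<open>\<sigma> \<union> {w}\<close>, this moves a point away from \<open>\<sigma>\<close>, parallel to the segment
  from the barycenter of \<open>\<sigma>\<close> to \<open>w\<close>: every vertex of \<open>\<sigma>\<close> gives up the fraction \<open>s\<close> of the least
  coordinate on \<open>\<sigma>\<close>, and \<open>w\<close> receives the total. At \<open>s = 1\<close> some vertex of \<open>\<sigma>\<close> is used up. The
  least coordinate vanishes as soon as a vertex of \<open>\<sigma>\<close> is missing from the support, so the same
  formula is the identity on the rest of the complex, and no maps have to be glued.
\<close>

definition push :: "'v set \<Rightarrow> 'v \<Rightarrow> real \<Rightarrow> ('v \<Rightarrow> real) \<Rightarrow> 'v \<Rightarrow> real" where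
  "push \<sigma> w s x u =
     x u + s * Min (x ` \<sigma>) * (if u \<in> \<sigma> then - 1 else if u = w then real (card \<sigma>) else 0)"

lemma push_0: "push \<sigma> w 0 x = x"
  by (auto simp: push_def)

lemma continuous_map_Min:
  fixes f :: "'a \<Rightarrow> 'b \<Rightarrow> real"
  assumes "finite S" "S \<noteq> {}" "\<And>u. u \<in> S \<Longrightarrow> continuous_map X euclideanreal (f u)"
  shows "continuous_map X euclideanreal (\<lambda>x. Min ((\<lambda>u. f u x) ` S))"
  using assms
proof (induction rule: finite_ne_induct)
  case (insert a F)
  then have "continuous_map X euclideanreal (\<lambda>x. min (f a x) (Min ((\<lambda>u. f u x) ` F)))"
    by (intro continuous_map_real_min) auto
  then show ?case using insert.hyps by simp
qed simp

lemma continuous_map_push: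
  assumes "finite \<sigma>" "\<sigma> \<noteq> {}"
  shows "continuous_map (prod_topology euclideanreal (powertop_real UNIV)) (powertop_real UNIV)
           (\<lambda>(s, x). push \<sigma> w s x)"
proof -
  let ?P = "prod_topology euclideanreal (powertop_real (UNIV :: 'a set))"
  have coord: "continuous_map ?P euclideanreal (\<lambda>p. snd p u)" for u
    using continuous_map_compose[OF continuous_map_snd continuous_map_product_projection[of u UNIV]]
    by (simp add: o_def)
  have "continuous_map ?P euclideanreal (\<lambda>p. Min ((\<lambda>u. snd p u) ` \<sigma>))"
    using assms coord by (intro continuous_map_Min)
  then have "continuous_map ?P euclideanreal
      (\<lambda>p. snd p u + fst p * Min (snd p ` \<sigma>) *
             (if u \<in> \<sigma> then - 1 else if u = w then real (card \<sigma>) else 0))" for u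
    by (intro continuous_map_add continuous_map_real_mult coord continuous_map_fst) auto
  then show ?thesis
    by (simp add: continuous_map_componentwise_UNIV push_def case_prod_unfold)
qed

text \<open>
  The support of a point need only be bounded by a simplex: as the coordinate sum is 1, the support
  is nonempty and hence a face.
\<close>

lemma realization_pointsI:
  assumes K: "finite_complex K" and "\<tau> \<in> K" and "\<And>v. 0 \<le> x v"
    and supp: "{v. x v \<noteq> 0} \<subseteq> \<tau>" and "sum x \<tau> = 1"
  shows "x \<in> realization_points K"
proof -
  have "finite \<tau>" using finite_complex_simplex[OF K \<open>\<tau> \<in> K\<close>] by blast
  then have "sum x {v. x v \<noteq> 0} = sum x \<tau>" using supp by (intro sum.mono_neutral_left) auto
  then have sum: "sum x {v. x v \<noteq> 0} = 1" using assms by simp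
  then have "{v. x v \<noteq> 0} \<noteq> {}" by fastforce
  then have "{v. x v \<noteq> 0} \<in> K" by (rule finite_complex_face[OF K \<open>\<tau> \<in> K\<close> _ supp])
  then show ?thesis using sum assms by (simp add: realization_points_def)
qed

text \<open>
  If the least coordinate on \<open>\<sigma>\<close> is positive, the support contains \<open>\<sigma>\<close>, so it is \<open>\<sigma>\<close> or
  \<open>\<sigma> \<union> {w}\<close> because \<open>\<sigma>\<close> is free, and the motion stays in that closed simplex. Otherwise the point
  does not move.
\<close>

lemma push_cases:
  assumes K: "finite_complex K" and \<sigma>: "\<sigma> \<in> K" "w \<notin> \<sigma>" "insert w \<sigma> \<in> K"
    and free: "\<And>\<rho>. \<rho> \<in> K \<Longrightarrow> \<sigma> \<subset> \<rho> \<Longrightarrow> \<rho> = insert w \<sigma>"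
    and x: "x \<in> realization_points K"
  shows push_in_realization: "0 \<le> s \<Longrightarrow> s \<le> 1 \<Longrightarrow> push \<sigma> w s x \<in> realization_points K"
    and push_1_in_realization: "push \<sigma> w 1 x \<in> realization_points (K - {\<sigma>, insert w \<sigma>})"
    and push_eq_self: "x \<in> realization_points (K - {\<sigma>, insert w \<sigma>}) \<Longrightarrow> push \<sigma> w s x = x"
proof -
  let ?\<tau> = "insert w \<sigma>" and ?m = "Min (x ` \<sigma>)" and ?L = "K - {\<sigma>, insert w \<sigma>}"
  have fin: "finite \<sigma>" and ne: "\<sigma> \<noteq> {}" using finite_complex_simplex[OF K \<sigma>(1)] by auto
  have x0: "\<And>v. 0 \<le> x v" and xK: "{v. x v \<noteq> 0} \<in> K" and x1: "(\<Sum>v | x v \<noteq> 0. x v) = 1"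
    using x by (auto simp: realization_points_def)
  have m_le: "\<And>u. u \<in> \<sigma> \<Longrightarrow> ?m \<le> x u" using fin by simp
  have "?m \<in> x ` \<sigma>" using fin ne by (intro Min_in) simp_all
  then obtain u0 where u0: "u0 \<in> \<sigma>" "x u0 = ?m" by force
  have m0: "?m \<ge> 0" using u0 x0[of u0] by simp
  have fixed: "push \<sigma> w r x = x" if "?m = 0" for r
    using that by (auto simp: push_def)
  show "push \<sigma> w s x = x" if "x \<in> realization_points ?L"
  proof -
    have "{v. x v \<noteq> 0} \<in> ?L" using that by (simp add: realization_points_def)
    then have "\<not> \<sigma> \<subseteq> {v. x v \<noteq> 0}" using free[of "{v. x v \<noteq> 0}"] by blast
    then obtain u where "u \<in> \<sigma>" "x u = 0" by blast
    then have "?m = 0" using m_le[of u] m0 by simp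
    then show ?thesis by (rule fixed)
  qed
  have pos: "push \<sigma> w r x \<in> realization_points K" "{v. push \<sigma> w r x v \<noteq> 0} \<subseteq> ?\<tau>"
    if "?m > 0" and r: "0 \<le> r" "r \<le> 1" for r
  proof -
    let ?y = "push \<sigma> w r x"
    have "x u > 0" if "u \<in> \<sigma>" for u using m_le[OF that] \<open>?m > 0\<close> by linarith
    then have "\<sigma> \<subseteq> {v. x v \<noteq> 0}" by fastforce
    then have supp: "{v. x v \<noteq> 0} \<subseteq> ?\<tau>" using free[OF xK] by blast
    show supp_y: "{v. ?y v \<noteq> 0} \<subseteq> ?\<tau>" using supp by (auto simp: push_def)
    have y0: "0 \<le> ?y v" for v
    proof (cases "v \<in> \<sigma>")
      case True
      have "r * ?m \<le> ?m" using r m0 by (simp add: mult_left_le_one_le)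
      then show ?thesis using True m_le[of v] by (simp add: push_def)
    next
      case False
      then show ?thesis using x0[of v] r m0 by (auto simp: push_def)
    qed
    have "sum x {v. x v \<noteq> 0} = sum x ?\<tau>"
      using supp fin by (intro sum.mono_neutral_left) simp_all
    then have "sum x ?\<tau> = 1" using x1 by simp
    moreover have "sum ?y \<sigma> = sum x \<sigma> - real (card \<sigma>) * (r * ?m)"
      by (simp add: push_def sum_subtractf)
    moreover have "?y w = x w + real (card \<sigma>) * (r * ?m)"
      using \<sigma>(2) by (simp add: push_def)
    ultimately have "sum ?y ?\<tau> = 1" using fin \<sigma>(2) by simp
    then show "?y \<in> realization_points K"
      using realization_pointsI[OF K \<sigma>(3) y0 supp_y] by blast
  qed
  show "push \<sigma> w s x \<in> realization_points K" if "0 \<le> s" "s \<le> 1"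
    using pos(1)[OF _ that] fixed[of s] x m0 by (cases "?m = 0") simp_all
  show "push \<sigma> w 1 x \<in> realization_points ?L"
  proof -
    let ?y = "push \<sigma> w 1 x"
    have yK: "?y \<in> realization_points K"
      using pos(1)[of 1] fixed[of 1] x m0 by (cases "?m = 0") simp_all
    \<comment> \<open>The vertex of least coordinate drops out of the support.\<close>
    have "?y u0 = 0" using u0 by (simp add: push_def)
    then have "{v. ?y v \<noteq> 0} \<noteq> \<sigma>" "{v. ?y v \<noteq> 0} \<noteq> ?\<tau>" using u0 by blast+
    then show ?thesis using yK by (simp add: realization_points_def)
  qed
qed

text \<open>
  The map \<open>push \<sigma> w 1\<close> is a retraction onto the smaller space, and letting \<open>s\<close> run from 0 to 1
  deforms the identity into it.
\<close>

lemma elementary_collapse_homotopy_equivalent: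
  assumes K: "finite_complex K" and KL: "elementary_collapse K L"
  shows "geometric_realization K homotopy_equivalent_space geometric_realization L"
proof -
  obtain \<sigma> w where \<sigma>: "\<sigma> \<in> K" "w \<notin> \<sigma>" "insert w \<sigma> \<in> K"
    "\<And>\<rho>. \<rho> \<in> K \<Longrightarrow> \<sigma> \<subset> \<rho> \<Longrightarrow> \<rho> = insert w \<sigma>" and L: "L = K - {\<sigma>, insert w \<sigma>}"
    using elementary_collapseE[OF K KL] by metis
  note push = push_cases[OF K \<sigma>, folded L]
  have fin: "finite \<sigma>" "\<sigma> \<noteq> {}" using finite_complex_simplex[OF K \<sigma>(1)] by auto
  let ?X = "geometric_realization K" and ?Y = "geometric_realization L"
  let ?H = "\<lambda>(s, x). push \<sigma> w s x"
  have LK: "realization_points L \<subseteq> realization_points K" by (auto simp: realization_points_def L)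
  have "continuous_map (subtopology (prod_topology euclideanreal (powertop_real UNIV))
          ({0..1} \<times> realization_points K)) (powertop_real UNIV) ?H"
    by (rule continuous_map_from_subtopology[OF continuous_map_push[OF fin]])
  then have contH: "continuous_map (prod_topology (top_of_set {0..1}) ?X) ?X ?H"
    using push(1) by (auto simp: geometric_realization_eq continuous_map_in_subtopology
        prod_topology_subtopology subtopology_subtopology Times_Int_Times)
  then have "homotopic_with (\<lambda>_. True) ?X ?X id (push \<sigma> w 1)"
    unfolding homotopic_with_def by (intro exI[of _ ?H]) (auto simp: push_0)
  then have hom: "homotopic_with (\<lambda>_. True) ?X ?X (push \<sigma> w 1) id"
    by (rule homotopic_with_symD)
  have "continuous_map ?X ?X (push \<sigma> w 1)"
    using homotopic_with_imp_continuous_maps[OF hom] by blast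
  then have "continuous_map ?X ?Y (push \<sigma> w 1)"
    using push(2) by (auto simp: geometric_realization_eq continuous_map_in_subtopology)
  moreover have "continuous_map ?Y ?X id"
    using LK by (auto simp: geometric_realization_eq continuous_map_in_subtopology
        intro: continuous_map_from_subtopology)
  ultimately have "retraction_maps ?X ?Y (push \<sigma> w 1) id"
    using push(3) LK
    by (auto simp: retraction_maps_def topspace_geometric_realization)
  then show ?thesis
    by (rule deformation_retract_imp_homotopy_equivalent_space[OF hom])
qed

lemma contractible_complex_vertex: "contractible_complex {{v}}"
proof -
  let ?X = "geometric_realization {{v}}" and ?e = "\<lambda>u. if u = v then 1 else 0 :: real"
  have "realization_points {{v}} = {?e}"
  proof -
    have "x = ?e" if "x \<in> realization_points {{v}}" for x
    proof
      fix u
      have "{u. x u \<noteq> 0} = {v}" "(\<Sum>u | x u \<noteq> 0. x u) = 1"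
        using that by (auto simp: realization_points_def)
      then show "x u = ?e u" by auto
    qed
    moreover have "?e \<in> realization_points {{v}}"
      by (auto simp: realization_points_def)
    ultimately show ?thesis by blast
  qed
  then have top: "topspace ?X = {?e}" by (simp add: topspace_geometric_realization)
  then have "?X = discrete_topology {?e}"
    using subtopology_eq_discrete_topology_sing subtopology_topspace by metis
  moreover have "homeomorphic_maps (discrete_topology {?e}) (discrete_topology {()}) (\<lambda>_. ()) (\<lambda>_. ?e)"
    by (simp add: homeomorphic_maps_def)
  then have "discrete_topology {?e} homeomorphic_space discrete_topology {()}"
    unfolding homeomorphic_space_def by blast
  ultimately show ?thesis
    unfolding contractible_complex_def
    using homeomorphic_imp_homotopy_equivalent_space by metis
qed

theorem collapsible_imp_contractible_complex:
  assumes "collapsible K" and "finite_complex K"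
  shows "contractible_complex K"
  using assms
proof (induction rule: collapsible_finite_complex_induct)
  case (vertex v)
  show ?case by (rule contractible_complex_vertex)
next
  case (collapse K L)
  then show ?case
    unfolding contractible_complex_def
    using elementary_collapse_homotopy_equivalent homotopy_eqv_trans by blast
qed

text \<open>
  A homotopy equivalence from the one-point space supplies a point of the realization.
\<close>

lemma contractible_complex_nonempty:
  assumes "contractible_complex K"
  shows "K \<noteq> {}"
proof
  assume "K = {}"
  then have empty: "topspace (geometric_realization K) = {}"
    by (simp add: geometric_realization_def)
  obtain g where "continuous_map (discrete_topology {()}) (geometric_realization K) g"
    using assms unfolding contractible_complex_def homotopy_equivalent_space_def by blast
  then have "g () \<in> topspace (geometric_realization K)"
    by (auto simp: continuous_map_def)
  then show False using empty by simp
qed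

lemma contractible_complexes_isomorphic_homology:
  assumes "contractible_complex K" and "contractible_complex L"
  shows "isomorphic_homology K L"
  using assms unfolding contractible_complex_def isomorphic_homology_def
  by (meson homotopy_equivalent_space_imp_isomorphic_homology_groups
      homotopy_equivalent_space_sym homotopy_eqv_trans)

theorem theorem3:
  fixes K :: "nat \<Rightarrow> 'v set set" and t :: nat
  assumes "filtration K"
    and "contractible_complex (K t)"
    and "\<not> collapsible (K t)"
  shows "minimal_morse_number (K t) \<ge> 2 \<and>
    (t \<ge> 1 \<and> collapsible (K (t - 1)) \<and> collapsible (K (t + 1)) \<longrightarrow>
       minimal_morse_number (K (t - 1)) = 1 \<and>
       minimal_morse_number (K (t + 1)) = 1 \<and>
       morse_spike K t)"
proof -
  have K: "finite_complex (K i)" for i using assms(1) by (simp add: filtration_def)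
  have M: "minimal_morse_number (K t) \<ge> 2"
    using not_collapsible_imp_minimal_morse_number_ge_2[OF K _ assms(3)]
      contractible_complex_nonempty[OF assms(2)] by blast
  have "minimal_morse_number (K i) = 1 \<and> contractible_complex (K i)" if "collapsible (K i)" for i
    using collapsible_imp_minimal_morse_number_eq_1[OF that K]
      collapsible_imp_contractible_complex[OF that K] by blast
  then show ?thesis
    using M assms(2) contractible_complexes_isomorphic_homology by (auto simp: morse_spike_def)
qed

end
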